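(* Let $X$ be a finite nonempty set and let $r$ be a Zadeh's fuzzy order on $X$. Then there exists a linear Zadeh's fuzzy order $r'$ on $X$ which extends $r$, i.e. $r(x,y)\le r'(x,y)$ for all $(x,y)\in X^2$.
   Context: A fuzzy relation on a nonempty set $X$ is a function $r: X\times X\to[0,1]$. A Zadeh's fuzzy order on $X$ is a fuzzy relation $r$ satisfying: (i) $r(x,x)=1$ for all $x\in X$; (ii) for all $x,y\in X$, if $x\neq y$ and $r(x,y)>0$ then $r(y,x)=0$; (iii) for all $x,z\in X$, $r(x,z)\ge \sup_{y\in X}\min\{r(x,y),r(y,z)\}$. A Zadeh's fuzzy order $r$ is linear if for all $x,y\in X$, $r(x,y)>0$ or $r(y,x)>0$. A Zadeh's fuzzy order $r'$ on $X$ is an extension of a Zadeh's fuzzy order $r$ on $X$ if $r(x,y)\le r'(x,y)$ for every $(x,y)\in X^2$. *)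

theory Defs
  imports Complex_Main
begin

(* Relations are total HOL functions; only their values on X \<times> X are constrained. *)

definition fuzzy_relation_on :: "'a set \<Rightarrow> ('a \<Rightarrow> 'a \<Rightarrow> real) \<Rightarrow> bool" where
  "fuzzy_relation_on X r \<longleftrightarrow> (\<forall>x\<in>X. \<forall>y\<in>X. r x y \<in> {0..1})"

(* The real-valued supremum is over a nonempty set bounded by 1 whenever x, z \<in> X, so it is
   the genuine least upper bound. *)

definition zadeh_fuzzy_order_on :: "'a set \<Rightarrow> ('a \<Rightarrow> 'a \<Rightarrow> real) \<Rightarrow> bool" where
  "zadeh_fuzzy_order_on X r \<longleftrightarrow>
     fuzzy_relation_on X r \<and>
     (\<forall>x\<in>X. r x x = 1) \<and>
     (\<forall>x\<in>X. \<forall>y\<in>X. x \<noteq> y \<and> r x y > 0 \<longrightarrow> r y x = 0) \<and>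
     (\<forall>x\<in>X. \<forall>z\<in>X. r x z \<ge> (SUP y\<in>X. min (r x y) (r y z)))"

definition linear_zadeh_fuzzy_order_on :: "'a set \<Rightarrow> ('a \<Rightarrow> 'a \<Rightarrow> real) \<Rightarrow> bool" where
  "linear_zadeh_fuzzy_order_on X r \<longleftrightarrow>
     zadeh_fuzzy_order_on X r \<and> (\<forall>x\<in>X. \<forall>y\<in>X. r x y > 0 \<or> r y x > 0)"

definition fuzzy_extends_on :: "'a set \<Rightarrow> ('a \<Rightarrow> 'a \<Rightarrow> real) \<Rightarrow> ('a \<Rightarrow> 'a \<Rightarrow> real) \<Rightarrow> bool" where
  "fuzzy_extends_on X r' r \<longleftrightarrow> (\<forall>x\<in>X. \<forall>y\<in>X. r x y \<le> r' x y)"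

end

(* The support of a Zadeh fuzzy order is a crisp partial order. On a finite set it has a linear
   extension, and the 0/1-valued indicator of that extension dominates r, since r is at most 1. *)
theory Submission
  imports Defs
begin

text \<open>Positivity of \<open>r\<close> is antisymmetric by the second order axiom and transitive
  because a minimum of two positive values is positive (\<open>zadeh_fuzzy_order_on_min_le\<close>).
  A linear extension is encoded by an injective monotone rank \<open>h\<close>
  (\<open>finite_partial_order_enumeration\<close>); comparing ranks then gives the linear fuzzy
  order (\<open>linear_zadeh_fuzzy_order_on_indicator\<close>).\<close>

lemma finite_partial_order_enumeration:
  fixes P :: "'a \<Rightarrow> 'a \<Rightarrow> bool"
  assumes fin: "finite X"
    and refl: "\<And>x. x \<in> X \<Longrightarrow> P x x"
    and antisym: "\<And>x y. \<lbrakk>x \<in> X; y \<in> X; P x y; P y x\<rbrakk> \<Longrightarrow> x = y"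
    and trans: "\<And>x y z. \<lbrakk>x \<in> X; y \<in> X; z \<in> X; P x y; P y z\<rbrakk> \<Longrightarrow> P x z"
  obtains h :: "'a \<Rightarrow> nat"
  where "inj_on h X" and "\<And>x y. \<lbrakk>x \<in> X; y \<in> X; P x y\<rbrakk> \<Longrightarrow> h x \<le> h y"
proof -
  define N where "N = card X"
  obtain g where "bij_betw g X {0..<N}"
    using ex_bij_betw_finite_nat[OF fin] unfolding N_def by blast
  then have g_inj: "inj_on g X" and g_less: "\<And>x. x \<in> X \<Longrightarrow> g x < N"
    by (auto simp: bij_betw_def)
  define c where "c x = card {y \<in> X. P y x}" for x
  \<comment> \<open>Order by the size of the down-set, breaking ties by \<open>g\<close>.\<close>
  define h where "h x = c x * N + g x" for x
  have "inj_on h X"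
  proof (rule inj_onI)
    fix x y assume x: "x \<in> X" and y: "y \<in> X" and "h x = h y"
    \<comment> \<open>Since \<open>g\<close> takes values below \<open>N\<close>, reducing
      \<open>h\<close> modulo \<open>N\<close> recovers \<open>g\<close>.\<close>
    then have "h x mod N = h y mod N" by simp
    then have "g x = g y"
      using g_less[OF x] g_less[OF y] by (simp add: h_def)
    then show "x = y" using g_inj x y by (simp add: inj_on_eq_iff)
  qed
  moreover have "h x \<le> h y" if x: "x \<in> X" and y: "y \<in> X" and xy: "P x y" for x y
  proof (cases "x = y")
    case False
    \<comment> \<open>The inclusion is strict because \<open>y\<close> lies in its own down-set but,
      by antisymmetry, not in that of \<open>x\<close>.\<close>
    have "{z \<in> X. P z x} \<subset> {z \<in> X. P z y}"
    proof (rule psubsetI)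
      show "{z \<in> X. P z x} \<subseteq> {z \<in> X. P z y}" using trans x y xy by blast
      show "{z \<in> X. P z x} \<noteq> {z \<in> X. P z y}" using refl antisym x y xy False by blast
    qed
    then have "c x < c y"
      unfolding c_def using fin by (intro psubset_card_mono) auto
    \<comment> \<open>A larger down-set adds at least \<open>N\<close> to the rank, which outweighs
      the tie-breaker \<open>g x < N\<close>.\<close>
    then have "Suc (c x) * N \<le> c y * N" by (intro mult_le_mono1) simp
    then show ?thesis using g_less[OF x] by (simp add: h_def)
  qed simp
  ultimately show thesis by (rule that)
qed

lemma zadeh_fuzzy_order_on_min_le:
  assumes "finite X" "zadeh_fuzzy_order_on X r" and "x \<in> X" "y \<in> X" "z \<in> X"
  shows "min (r x y) (r y z) \<le> r x z"
proof -
  \<comment> \<open>Finiteness of \<open>X\<close> makes the family bounded above, so the real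
    supremum dominates each member.\<close>
  have "min (r x y) (r y z) \<le> (SUP y\<in>X. min (r x y) (r y z))"
    using assms by (intro cSUP_upper bdd_above_finite finite_imageI)
  also have "\<dots> \<le> r x z"
    using assms by (simp add: zadeh_fuzzy_order_on_def)
  finally show ?thesis .
qed

text \<open>The minimum is 1 only along a chain \<open>h x \<le> h y \<le> h z\<close>, so
  transitivity in the codomain bounds the supremum. Injectivity turns equal ranks into equal points,
  which gives antisymmetry.\<close>

lemma linear_zadeh_fuzzy_order_on_indicator:
  fixes h :: "'a \<Rightarrow> 'b::linorder"
  assumes "X \<noteq> {}" and inj: "inj_on h X"
  shows "linear_zadeh_fuzzy_order_on X (\<lambda>x y. if h x \<le> h y then 1 else 0)"
proof -
  have "(SUP y\<in>X. min (if h x \<le> h y then 1 else 0) (if h y \<le> h z then 1 else 0))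
      \<le> (if h x \<le> h z then 1 else (0::real))" for x z
    using assms(1) by (intro cSUP_least) auto
  then show ?thesis
    using inj
    by (auto simp: linear_zadeh_fuzzy_order_on_def zadeh_fuzzy_order_on_def
        fuzzy_relation_on_def inj_on_eq_iff)
qed

theorem theorem2p1:
  fixes X :: "'a set" and r :: "'a \<Rightarrow> 'a \<Rightarrow> real"
  assumes "finite X" and "X \<noteq> {}"
    and "zadeh_fuzzy_order_on X r"
  shows "\<exists>r'. linear_zadeh_fuzzy_order_on X r' \<and> fuzzy_extends_on X r' r"
proof -
  have bounds: "0 \<le> r x y \<and> r x y \<le> 1" if "x \<in> X" "y \<in> X" for x y
    using assms(3) that by (auto simp: zadeh_fuzzy_order_on_def fuzzy_relation_on_def)
  obtain h :: "'a \<Rightarrow> nat" where inj: "inj_on h X"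
    and mono: "\<And>x y. \<lbrakk>x \<in> X; y \<in> X; r x y > 0\<rbrakk> \<Longrightarrow> h x \<le> h y"
  proof (rule finite_partial_order_enumeration[of X "\<lambda>x y. r x y > 0"])
    show "finite X" by fact
    show "r x x > 0" if "x \<in> X" for x
      using assms(3) that by (simp add: zadeh_fuzzy_order_on_def)
    show "x = y" if "x \<in> X" "y \<in> X" "r x y > 0" "r y x > 0" for x y
      using assms(3) that unfolding zadeh_fuzzy_order_on_def by (metis less_irrefl)
    show "r x z > 0" if "x \<in> X" "y \<in> X" "z \<in> X" "r x y > 0" "r y z > 0" for x y z
      using zadeh_fuzzy_order_on_min_le[OF assms(1,3) that(1-3)] that(4,5) by linarith
  qed blast
  \<comment> \<open>Where the indicator is 0, the contrapositive of \<open>mono\<close> gives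
    \<open>r x y \<le> 0\<close>; elsewhere \<open>r x y \<le> 1\<close> suffices.\<close>
  have "fuzzy_extends_on X (\<lambda>x y. if h x \<le> h y then 1 else 0) r"
    unfolding fuzzy_extends_on_def using bounds mono by (auto simp: not_less[symmetric])
  with linear_zadeh_fuzzy_order_on_indicator[OF assms(2) inj] show ?thesis by blast
qed

end
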